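(* Let $A$ be a common subgroup of left-orderable groups $G$ and $H$, and let $<_G$, $<_H$ be discrete left-orderings of $G$, $H$ such that (a) $<_G$ and $<_H$ restrict to the same left-ordering $<_A$ of $A$; (b) $A$ is a stepping with respect to both $<_G$ and $<_H$; (c) $<_G$ is isolated and $<_H$ is relatively isolated with respect to $A$. Let $X=G*_A H$ and let $<_X$ be one of the isolated orderings $<_X^{(1)}$, $<_X^{(2)}$ of $X$ described in the context. If a subgroup $B$ of $A$ is both $(G,<_G)$-strongly convex and $(H,<_H)$-strongly convex, then $B$ is $(X,<_X)$-strongly convex. In particular, if $B$ and $B'$ are two different such subgroups, then $\mathsf{Conv}_X(B)$ and $\mathsf{Conv}_X(B')$ are different convex subgroups of $(X,<_X)$.
   Context: A left-ordering of a group $G$ is a total ordering $<_G$ with $a<_G b\Rightarrow ga<_G gb$ for all $a,b,g\in G$. It is discrete if there is a minimal element among the elements $>_G 1$ (the minimal positive element). $\mathrm{LO}(G)$ is the set of left-orderings of $G$, with the topology having open sub-basis $U_g=\{<_G: 1<_G g\}$, $g\in G$; $<_G$ is isolated if it is an isolated point of $\mathrm{LO}(G)$. For a subgroup $A\subset G$ and the restriction map $\mathsf{Res}:\mathrm{LO}(G)\to\mathrm{LO}(A)$, $<_G$ is relatively isolated with respect to $A$ if it is an isolated point of the subspace $\mathsf{Res}^{-1}(\mathsf{Res}(<_G))$. A subgroup $A\subset G$ is a stepping with respect to $<_G$ if for each $g\in G$ both $\max_{<_G}\{a\in A: a\le_G g\}$ and $\min_{<_G}\{a\in A: g<_G a\}$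 exist; in that case the restriction of $<_G$ to $A$ is discrete. Let $a_{\sf min}, g_{\sf min}, h_{\sf min}$ be the minimal positive elements of $<_A,<_G,<_H$. Under hypotheses (a), (b), (c), it is known that there is exactly one left-ordering $<_X^{(1)}$ of $X=G*_AH$ which extends both $<_G$ and $<_H$ and satisfies $1<_X^{(1)}h_{\sf min}a_{\sf min}^{-1}g_{\sf min}$, and exactly one left-ordering $<_X^{(2)}$ of $X$ which extends both $<_G$ and $<_H$ and satisfies $1<_X^{(2)}g_{\sf min}a_{\sf min}^{-1}h_{\sf min}$. Both are isolated and discrete; $h_{\sf min}a_{\sf min}^{-1}g_{\sf min}$ is the minimal positive element of $<_X^{(1)}$, $g_{\sf min}a_{\sf min}^{-1}h_{\sf min}$ is the minimal positive element of $<_X^{(2)}$, and $A$ is a stepping with respect to both. These are the orderings referred to in the claim. A subset $C$ of a totally ordered set $(S,<_S)$ is convex if $c\le_S s\le_S c'$ with $c,c'\in C$, $s\in S$ implies $s\in C$. For $T\subset S$, the convex hull is $\mathsf{Conv}_S(T)=\{s\in S:\exists\, t,t'\in T,\ t\le_S s\le_S t'\}$. For a left-ordered group $(G,<_G)$ and a subgroup $A$ of $G$ with the restricted ordering $<_A$, a convex subgroup $B$ of $(A,<_A)$ is $(G,<_G)$-strongly convex if $\mathsf{Conv}_G(B)$ is a subgroup of $G$ (and likewise with $H$ or $X$ in place of $G$). *)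

theory Defs
  imports "HOL-Algebra.Coset" "HOL-Analysis.Abstract_Topology"
begin

section \<open>Left-orderings\<close>

text \<open>
  An ordering is represented by its strict part, as a set of pairs contained in
  \<open>carrier G \<times> carrier G\<close>, so that two orderings are equal as orderings of the carrier
  iff they are equal as sets; \<open>r\<^sup>=\<close> is the corresponding non-strict order.
\<close>

definition left_ordering :: "('g, 'm) monoid_scheme \<Rightarrow> 'g rel \<Rightarrow> bool" where
  "left_ordering G r \<longleftrightarrow>
     r \<subseteq> carrier G \<times> carrier G \<and>
     strict_linear_order_on (carrier G) r \<and>
     (\<forall>a\<in>carrier G. \<forall>b\<in>carrier G. \<forall>g\<in>carrier G.
        (a, b) \<in> r \<longrightarrow> (g \<otimes>\<^bsub>G\<^esub> a, g \<otimes>\<^bsub>G\<^esub> b) \<in> r)"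

definition LO :: "('g, 'm) monoid_scheme \<Rightarrow> 'g rel set" where
  "LO G = {r. left_ordering G r}"

definition min_positive :: "('g, 'm) monoid_scheme \<Rightarrow> 'g rel \<Rightarrow> 'g \<Rightarrow> bool" where
  "min_positive G r p \<longleftrightarrow>
     p \<in> carrier G \<and> (\<one>\<^bsub>G\<^esub>, p) \<in> r \<and>
     (\<forall>x\<in>carrier G. (\<one>\<^bsub>G\<^esub>, x) \<in> r \<longrightarrow> (p, x) \<in> r\<^sup>=)"

definition discrete_ordering :: "('g, 'm) monoid_scheme \<Rightarrow> 'g rel \<Rightarrow> bool" where
  "discrete_ordering G r \<longleftrightarrow> (\<exists>p. min_positive G r p)"

text \<open>
  \<open>LO G\<close> itself is added to the sub-basis: it is the empty intersection, which
  \<^const>\<open>topology_generated_by\<close> does not supply. This matters only for the trivial group.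
\<close>

definition LO_topology :: "('g, 'm) monoid_scheme \<Rightarrow> 'g rel topology" where
  "LO_topology G = topology_generated_by
     (insert (LO G) {{r \<in> LO G. (\<one>\<^bsub>G\<^esub>, g) \<in> r} | g. g \<in> carrier G})"

definition isolated_ordering :: "('g, 'm) monoid_scheme \<Rightarrow> 'g rel \<Rightarrow> bool" where
  "isolated_ordering G r \<longleftrightarrow> r \<in> LO G \<and> openin (LO_topology G) {r}"

text \<open>
  In what follows a subgroup of \<open>G\<close> is given by a group \<open>A\<close> and an embedding
  \<open>i \<in> mon A G\<close>; an honest subgroup is the case \<open>i = id\<close>. \<open>Res A i r\<close> is then the
  restriction of the ordering \<open>r\<close> of \<open>G\<close> to \<open>A\<close>, as an ordering of \<open>A\<close>. In particular
  \<open>Res A i r = s\<close> says that \<open>r\<close> extends \<open>s\<close> along \<open>i\<close>.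
\<close>

definition Res :: "('a, 'n) monoid_scheme \<Rightarrow> ('a \<Rightarrow> 'g) \<Rightarrow> 'g rel \<Rightarrow> 'a rel" where
  "Res A i r = {(a, b). a \<in> carrier A \<and> b \<in> carrier A \<and> (i a, i b) \<in> r}"

definition relatively_isolated ::
  "('g, 'm) monoid_scheme \<Rightarrow> 'g rel \<Rightarrow> ('a, 'n) monoid_scheme \<Rightarrow> ('a \<Rightarrow> 'g) \<Rightarrow> bool" where
  "relatively_isolated G r A i \<longleftrightarrow>
     r \<in> LO G \<and>
     openin (subtopology (LO_topology G) {s \<in> LO G. Res A i s = Res A i r}) {r}"

definition stepping ::
  "('g, 'm) monoid_scheme \<Rightarrow> 'g rel \<Rightarrow> ('a, 'n) monoid_scheme \<Rightarrow> ('a \<Rightarrow> 'g) \<Rightarrow> bool" where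
  "stepping G r A i \<longleftrightarrow>
     (\<forall>g\<in>carrier G.
        (\<exists>m\<in>carrier A. (i m, g) \<in> r\<^sup>= \<and>
           (\<forall>a\<in>carrier A. (i a, g) \<in> r\<^sup>= \<longrightarrow> (i a, i m) \<in> r\<^sup>=)) \<and>
        (\<exists>m\<in>carrier A. (g, i m) \<in> r \<and>
           (\<forall>a\<in>carrier A. (g, i a) \<in> r \<longrightarrow> (i m, i a) \<in> r\<^sup>=)))"

definition order_convex :: "'s set \<Rightarrow> 's rel \<Rightarrow> 's set \<Rightarrow> bool" where
  "order_convex S r C \<longleftrightarrow>
     C \<subseteq> S \<and>
     (\<forall>c\<in>C. \<forall>c'\<in>C. \<forall>s\<in>S. (c, s) \<in> r\<^sup>= \<and> (s, c') \<in> r\<^sup>= \<longrightarrow> s \<in> C)"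

definition Conv :: "'s set \<Rightarrow> 's rel \<Rightarrow> 's set \<Rightarrow> 's set" where
  "Conv S r T = {s \<in> S. \<exists>t\<in>T. \<exists>t'\<in>T. (t, s) \<in> r\<^sup>= \<and> (s, t') \<in> r\<^sup>=}"

definition strongly_convex ::
  "('g, 'm) monoid_scheme \<Rightarrow> 'g rel \<Rightarrow> ('a, 'n) monoid_scheme \<Rightarrow> ('a \<Rightarrow> 'g) \<Rightarrow> 'a set \<Rightarrow> bool"
  where
  "strongly_convex G r A i B \<longleftrightarrow>
     subgroup B A \<and> order_convex (carrier A) (Res A i r) B \<and>
     subgroup (Conv (carrier G) r (i ` B)) G"


section \<open>Amalgamated free products\<close>

text \<open>
  Words in the disjoint union of \<open>G\<close> and \<open>H\<close>, modulo the congruence generated by the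
  multiplication tables of \<open>G\<close> and \<open>H\<close> and by the identification of \<open>i a\<close> with \<open>j a\<close>.
\<close>

abbreviation amalgam_words ::
  "('g, 'm) monoid_scheme \<Rightarrow> ('h, 'k) monoid_scheme \<Rightarrow> ('g + 'h) list set" where
  "amalgam_words G H \<equiv> lists (carrier G <+> carrier H)"

inductive_set amalgam_rel ::
  "('g, 'm) monoid_scheme \<Rightarrow> ('h, 'k) monoid_scheme \<Rightarrow> ('a, 'n) monoid_scheme \<Rightarrow>
   ('a \<Rightarrow> 'g) \<Rightarrow> ('a \<Rightarrow> 'h) \<Rightarrow> ('g + 'h) list rel"
  for G and H and A and i and j
  where
    refl: "w \<in> amalgam_words G H \<Longrightarrow> (w, w) \<in> amalgam_rel G H A i j"
  | sym: "(v, w) \<in> amalgam_rel G H A i j \<Longrightarrow> (w, v) \<in> amalgam_rel G H A i j"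
  | trans: "(u, v) \<in> amalgam_rel G H A i j \<Longrightarrow> (v, w) \<in> amalgam_rel G H A i j \<Longrightarrow>
      (u, w) \<in> amalgam_rel G H A i j"
  | cong: "(v, w) \<in> amalgam_rel G H A i j \<Longrightarrow>
      p \<in> amalgam_words G H \<Longrightarrow> q \<in> amalgam_words G H \<Longrightarrow>
      (p @ v @ q, p @ w @ q) \<in> amalgam_rel G H A i j"
  | mult_left: "x \<in> carrier G \<Longrightarrow> y \<in> carrier G \<Longrightarrow>
      ([Inl x, Inl y], [Inl (x \<otimes>\<^bsub>G\<^esub> y)]) \<in> amalgam_rel G H A i j"
  | mult_right: "x \<in> carrier H \<Longrightarrow> y \<in> carrier H \<Longrightarrow>
      ([Inr x, Inr y], [Inr (x \<otimes>\<^bsub>H\<^esub> y)]) \<in> amalgam_rel G H A i j"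
  | one_left: "([Inl \<one>\<^bsub>G\<^esub>], []) \<in> amalgam_rel G H A i j"
  | one_right: "([Inr \<one>\<^bsub>H\<^esub>], []) \<in> amalgam_rel G H A i j"
  | glue: "a \<in> carrier A \<Longrightarrow> ([Inl (i a)], [Inr (j a)]) \<in> amalgam_rel G H A i j"

definition amalgam ::
  "('g, 'm) monoid_scheme \<Rightarrow> ('h, 'k) monoid_scheme \<Rightarrow> ('a, 'n) monoid_scheme \<Rightarrow>
   ('a \<Rightarrow> 'g) \<Rightarrow> ('a \<Rightarrow> 'h) \<Rightarrow> ('g + 'h) list set monoid" where
  "amalgam G H A i j =
     \<lparr>carrier = amalgam_words G H // amalgam_rel G H A i j,
      mult = (\<lambda>C D. \<Union>v\<in>C. \<Union>w\<in>D. amalgam_rel G H A i j `` {v @ w}),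
      one = amalgam_rel G H A i j `` {[]}\<rparr>"

definition amalgam_inl ::
  "('g, 'm) monoid_scheme \<Rightarrow> ('h, 'k) monoid_scheme \<Rightarrow> ('a, 'n) monoid_scheme \<Rightarrow>
   ('a \<Rightarrow> 'g) \<Rightarrow> ('a \<Rightarrow> 'h) \<Rightarrow> 'g \<Rightarrow> ('g + 'h) list set" where
  "amalgam_inl G H A i j x = amalgam_rel G H A i j `` {[Inl x]}"

definition amalgam_inr ::
  "('g, 'm) monoid_scheme \<Rightarrow> ('h, 'k) monoid_scheme \<Rightarrow> ('a, 'n) monoid_scheme \<Rightarrow>
   ('a \<Rightarrow> 'g) \<Rightarrow> ('a \<Rightarrow> 'h) \<Rightarrow> 'h \<Rightarrow> ('g + 'h) list set" where
  "amalgam_inr G H A i j y = amalgam_rel G H A i j `` {[Inr y]}"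

text \<open>The amalgam is a group, and it is the pushout of \<open>G\<close> and \<open>H\<close> along \<open>A\<close>.\<close>

locale amalgam_data =
  fixes G :: "('g, 'm) monoid_scheme" and H :: "('h, 'k) monoid_scheme"
    and A :: "('a, 'n) monoid_scheme"
    and i :: "'a \<Rightarrow> 'g" and j :: "'a \<Rightarrow> 'h"
  assumes G: "group G" and H: "group H" and A: "group A"
    and i: "i \<in> hom A G" and j: "j \<in> hom A H"
begin

abbreviation "W \<equiv> amalgam_words G H"
abbreviation "E \<equiv> amalgam_rel G H A i j"
abbreviation "X \<equiv> amalgam G H A i j"

lemma rel_words: "(v, w) \<in> E \<Longrightarrow> v \<in> W \<and> w \<in> W"
proof (induction rule: amalgam_rel.induct)
  case (glue a)
  then show ?case using i j by (auto simp: hom_def)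
qed (use G H in \<open>auto simp: group.is_monoid monoid.m_closed monoid.one_closed\<close>)

lemma equiv_rel: "equiv W E"
  by (auto simp: equiv_def refl_on_def sym_def trans_def dest: rel_words
      intro: amalgam_rel.refl amalgam_rel.sym amalgam_rel.trans)

lemma rel_append: "(v, v') \<in> E \<Longrightarrow> (w, w') \<in> E \<Longrightarrow> (v @ w, v' @ w') \<in> E"
  using amalgam_rel.cong[of v v' G H A i j "[]" w] amalgam_rel.cong[of w w' G H A i j v' "[]"]
  by (auto dest: rel_words intro: amalgam_rel.trans)

lemma class_eq_iff: "v \<in> W \<Longrightarrow> w \<in> W \<Longrightarrow> E `` {v} = E `` {w} \<longleftrightarrow> (v, w) \<in> E"
  using eq_equiv_class_iff[OF equiv_rel] by blast

lemma class_eqI: "(v, w) \<in> E \<Longrightarrow> E `` {v} = E `` {w}"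
  using equiv_class_eq[OF equiv_rel] by blast

lemma class_closed: "v \<in> W \<Longrightarrow> E `` {v} \<in> carrier X"
  by (auto simp: amalgam_def quotient_def)

lemma carrierE:
  assumes "c \<in> carrier X" obtains v where "v \<in> W" "c = E `` {v}"
  using assms by (auto simp: amalgam_def quotient_def)

lemma one_class: "\<one>\<^bsub>X\<^esub> = E `` {[]}"
  by (simp add: amalgam_def)

lemma mult_class: "v \<in> W \<Longrightarrow> w \<in> W \<Longrightarrow> E `` {v} \<otimes>\<^bsub>X\<^esub> E `` {w} = E `` {v @ w}"
  unfolding amalgam_def
  by simp (rule UN_equiv_class2[OF equiv_rel equiv_rel],
      auto simp: congruent2_def intro!: class_eqI rel_append)

lemma word_inverse: "v \<in> W \<Longrightarrow> \<exists>w\<in>W. (w @ v, []) \<in> E"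
proof (induction v)
  case Nil
  then show ?case by (intro bexI[of _ "[]"]) (auto intro: amalgam_rel.refl)
next
  case (Cons x v)
  then obtain w where w: "w \<in> W" "(w @ v, []) \<in> E" by auto
  have v: "v \<in> W" using Cons.prems by auto
  obtain y where y: "[y] \<in> W" "([y, x], []) \<in> E"
  proof (cases x)
    case (Inl g)
    then have g: "g \<in> carrier G" using Cons.prems by auto
    have "([Inl (inv\<^bsub>G\<^esub> g), Inl g], [Inl \<one>\<^bsub>G\<^esub>]) \<in> E"
      using amalgam_rel.mult_left[of "inv\<^bsub>G\<^esub> g" G g H A i j] g G
      by (simp add: group.l_inv)
    then have "([Inl (inv\<^bsub>G\<^esub> g), x], []) \<in> E"
      unfolding Inl by (rule amalgam_rel.trans[OF _ amalgam_rel.one_left])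
    then show ?thesis using that[of "Inl (inv\<^bsub>G\<^esub> g)"] g G
      by (simp add: group.inv_closed InlI InrI)
  next
    case (Inr h)
    then have h: "h \<in> carrier H" using Cons.prems by auto
    have "([Inr (inv\<^bsub>H\<^esub> h), Inr h], [Inr \<one>\<^bsub>H\<^esub>]) \<in> E"
      using amalgam_rel.mult_right[of "inv\<^bsub>H\<^esub> h" H h G A i j] h H
      by (simp add: group.l_inv)
    then have "([Inr (inv\<^bsub>H\<^esub> h), x], []) \<in> E"
      unfolding Inr by (rule amalgam_rel.trans[OF _ amalgam_rel.one_right])
    then show ?thesis using that[of "Inr (inv\<^bsub>H\<^esub> h)"] h H
      by (simp add: group.inv_closed InlI InrI)
  qed
  have "(w @ [y, x] @ v, w @ [] @ v) \<in> E"
    using y(2) w(1) v by (rule amalgam_rel.cong)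
  then have "(w @ [y, x] @ v, []) \<in> E"
    using w(2) by (auto intro: amalgam_rel.trans)
  then show ?case using y w by (intro bexI[of _ "w @ [y]"]) auto
qed

lemma amalgam_group: "group X"
proof (rule groupI)
  fix x y assume "x \<in> carrier X" "y \<in> carrier X"
  then show "x \<otimes>\<^bsub>X\<^esub> y \<in> carrier X"
    by (elim carrierE) (simp add: mult_class class_closed)
next
  fix x y z assume "x \<in> carrier X" "y \<in> carrier X" "z \<in> carrier X"
  then show "x \<otimes>\<^bsub>X\<^esub> y \<otimes>\<^bsub>X\<^esub> z = x \<otimes>\<^bsub>X\<^esub> (y \<otimes>\<^bsub>X\<^esub> z)"
    by (elim carrierE) (simp add: mult_class)
next
  fix x assume "x \<in> carrier X"
  then obtain v where v: "v \<in> W" "x = E `` {v}" by (rule carrierE)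
  then obtain w where w: "w \<in> W" "(w @ v, []) \<in> E" using word_inverse by blast
  show "\<exists>y\<in>carrier X. y \<otimes>\<^bsub>X\<^esub> x = \<one>\<^bsub>X\<^esub>"
    using v w by (intro bexI[of _ "E `` {w}"])
      (auto simp: mult_class one_class intro!: class_eqI class_closed)
  show "\<one>\<^bsub>X\<^esub> \<otimes>\<^bsub>X\<^esub> x = x"
    using v by (simp add: one_class mult_class)
qed (simp add: one_class class_closed)

lemma amalgam_inl_hom: "amalgam_inl G H A i j \<in> hom G X"
proof (rule homI)
  fix x y assume xy: "x \<in> carrier G" "y \<in> carrier G"
  then have "E `` {[Inl (x \<otimes>\<^bsub>G\<^esub> y)]} = E `` {[Inl x, Inl y]}"
    by (intro class_eqI amalgam_rel.sym[OF amalgam_rel.mult_left])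
  with xy show "amalgam_inl G H A i j (x \<otimes>\<^bsub>G\<^esub> y) =
      amalgam_inl G H A i j x \<otimes>\<^bsub>X\<^esub> amalgam_inl G H A i j y"
    by (simp add: amalgam_inl_def mult_class InlI InrI)
qed (simp add: amalgam_inl_def class_closed InlI InrI)

lemma amalgam_inr_hom: "amalgam_inr G H A i j \<in> hom H X"
proof (rule homI)
  fix x y assume xy: "x \<in> carrier H" "y \<in> carrier H"
  then have "E `` {[Inr (x \<otimes>\<^bsub>H\<^esub> y)]} = E `` {[Inr x, Inr y]}"
    by (intro class_eqI amalgam_rel.sym[OF amalgam_rel.mult_right])
  with xy show "amalgam_inr G H A i j (x \<otimes>\<^bsub>H\<^esub> y) =
      amalgam_inr G H A i j x \<otimes>\<^bsub>X\<^esub> amalgam_inr G H A i j y"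
    by (simp add: amalgam_inr_def mult_class InlI InrI)
qed (simp add: amalgam_inr_def class_closed InlI InrI)

lemma amalgam_glue:
  "a \<in> carrier A \<Longrightarrow> amalgam_inl G H A i j (i a) = amalgam_inr G H A i j (j a)"
  by (auto simp: amalgam_inl_def amalgam_inr_def intro!: class_eqI amalgam_rel.glue)

lemma amalgam_universal:
  fixes K :: "('x, 'y) monoid_scheme"
  assumes K: "group K" and f: "f \<in> hom G K" and f': "f' \<in> hom H K"
    and eq: "\<And>a. a \<in> carrier A \<Longrightarrow> f (i a) = f' (j a)"
  obtains F where "F \<in> hom X K"
    and "\<And>x. x \<in> carrier G \<Longrightarrow> F (amalgam_inl G H A i j x) = f x"
    and "\<And>y. y \<in> carrier H \<Longrightarrow> F (amalgam_inr G H A i j y) = f' y"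
proof -
  interpret K: group K by (rule K)
  define ev where "ev = (\<lambda>w. foldr (\<lambda>s k. case_sum f f' s \<otimes>\<^bsub>K\<^esub> k) w \<one>\<^bsub>K\<^esub>)"
  have ev_simps [simp]: "ev [] = \<one>\<^bsub>K\<^esub>" "ev (s # w) = case_sum f f' s \<otimes>\<^bsub>K\<^esub> ev w" for s w
    by (auto simp: ev_def)
  have cl: "x \<in> carrier G \<Longrightarrow> f x \<in> carrier K" "y \<in> carrier H \<Longrightarrow> f' y \<in> carrier K" for x y
    using f f' by (auto simp: hom_def)
  have evc: "w \<in> W \<Longrightarrow> ev w \<in> carrier K" for w
    by (induction w) (auto simp: cl)
  have app: "ev (v @ w) = ev v \<otimes>\<^bsub>K\<^esub> ev w" if "v \<in> W" and w: "w \<in> W" for v w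
    using that(1) evc[OF w]
  proof (induction v)
    case (Cons s v)
    then have "ev v \<in> carrier K" using evc[of v] by auto
    with Cons show ?case by (auto simp: cl K.m_assoc)
  qed simp
  have resp: "(v, w) \<in> E \<Longrightarrow> ev v = ev w" for v w
  proof (induction rule: amalgam_rel.induct)
    case (cong v w p q)
    then show ?case using rel_words by (simp add: app evc)
  next
    case (glue a)
    then show ?case by (simp add: eq)
  next
    case one_left
    then show ?case using f G K by (simp add: hom_one)
  next
    case one_right
    then show ?case using f' H K by (simp add: hom_one)
  next
    case (mult_left x y)
    then show ?case using f by (simp add: hom_mult cl)
  next
    case (mult_right x y)
    then show ?case using f' by (simp add: hom_mult cl)
  qed auto
  define F where "F = (\<lambda>c. ev (SOME w. w \<in> c))"
  have F: "F (E `` {w}) = ev w" if "w \<in> W" for w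
  proof -
    have "(w, SOME v. v \<in> E `` {w}) \<in> E"
      using someI[of "\<lambda>v. v \<in> E `` {w}" w] amalgam_rel.refl[OF that] by auto
    then show ?thesis using resp by (auto simp: F_def)
  qed
  show ?thesis
  proof (rule that[of F])
    show "F \<in> hom X K"
    proof (rule homI)
      fix x assume "x \<in> carrier X"
      then show "F x \<in> carrier K" by (elim carrierE) (simp add: F evc)
    next
      fix x y assume "x \<in> carrier X" "y \<in> carrier X"
      then show "F (x \<otimes>\<^bsub>X\<^esub> y) = F x \<otimes>\<^bsub>K\<^esub> F y"
        by (elim carrierE) (simp add: F app mult_class)
    qed
  qed (simp_all add: amalgam_inl_def amalgam_inr_def F cl InlI InrI)
qed

lemma amalgam_unique:
  assumes K: "group K" and F: "F \<in> hom X K" and F': "F' \<in> hom X K"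
    and l: "\<And>x. x \<in> carrier G \<Longrightarrow> F (amalgam_inl G H A i j x) = F' (amalgam_inl G H A i j x)"
    and r: "\<And>y. y \<in> carrier H \<Longrightarrow> F (amalgam_inr G H A i j y) = F' (amalgam_inr G H A i j y)"
    and c: "c \<in> carrier X"
  shows "F c = F' c"
proof -
  have "w \<in> W \<Longrightarrow> F (E `` {w}) = F' (E `` {w})" for w
  proof (induction w)
    case Nil
    then show ?case
      using hom_one[OF F amalgam_group K] hom_one[OF F' amalgam_group K]
      by (simp add: one_class)
  next
    case (Cons s w)
    then have s: "[s] \<in> W" and w: "w \<in> W" by auto
    have "F (E `` {[s]}) = F' (E `` {[s]})"
      using s l r by (cases s) (auto simp: amalgam_inl_def amalgam_inr_def)
    moreover have "E `` {s # w} = E `` {[s]} \<otimes>\<^bsub>X\<^esub> E `` {w}"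
      using mult_class[OF s w] by simp
    ultimately show ?case
      using Cons.IH[OF w] hom_mult[OF F] hom_mult[OF F'] s w class_closed by metis
  qed
  then show ?thesis using carrierE[OF c] by metis
qed

end

end

(*
  Write a, g, h for the minimal positive elements of A, G, H and suppose 1 < h a^-1 g; the other
  case is symmetric. The assumption means a h^-1 < g: between 1 and a, the elements of H lie
  below the nontrivial elements of G. By induction on the length, a reduced word starting in
  H - A lies strictly between b and b g, and one starting in G - A strictly between b a h^-1 and
  b a, for some b in A. So if a word s z starting with a letter s lies in Conv_X(B), then s can
  be corrected by an element of A to a letter in Conv_G(B) or Conv_H(B) with a remainder that is
  in Conv_X(B) again. Hence Conv_X(B) is contained in the subgroup generated by Conv_G(B) and
  Conv_H(B). Conversely, left multiplication by these two subgroups preserves Conv_X(B), as B is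
  cofinal in both.
*)

theory Submission
  imports Defs "HOL-Algebra.Generated_Groups"
begin

section \<open>Left-ordered groups and convex hulls of subgroups\<close>

locale left_ordered_group = group X for X (structure) +
  fixes r :: "'a rel"
  assumes left_ordering: "left_ordering X r"
begin

abbreviation lt (infix "\<prec>" 50) where "x \<prec> y \<equiv> (x, y) \<in> r"
abbreviation le (infix "\<preceq>" 50) where "x \<preceq> y \<equiv> (x, y) \<in> r\<^sup>="

lemma lt_closed: "x \<prec> y \<Longrightarrow> x \<in> carrier X" "x \<prec> y \<Longrightarrow> y \<in> carrier X"
  using left_ordering by (auto simp: left_ordering_def)

lemma lt_total: "x \<in> carrier X \<Longrightarrow> y \<in> carrier X \<Longrightarrow> x \<prec> y \<or> x = y \<or> y \<prec> x"
  using left_ordering by (auto simp: left_ordering_def strict_linear_order_on_def total_on_def)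

lemma mult_lt: "g \<in> carrier X \<Longrightarrow> x \<prec> y \<Longrightarrow> g \<otimes> x \<prec> g \<otimes> y"
  using left_ordering lt_closed by (auto simp: left_ordering_def)

lemma mult_le: "g \<in> carrier X \<Longrightarrow> x \<preceq> y \<Longrightarrow> g \<otimes> x \<preceq> g \<otimes> y"
  using mult_lt by auto

lemma lt_trans: "x \<prec> y \<Longrightarrow> y \<prec> z \<Longrightarrow> x \<prec> z"
  and lt_irrefl: "\<not> x \<prec> x"
  using left_ordering
  by (auto simp: left_ordering_def strict_linear_order_on_def irrefl_def dest: transD)

text \<open>\<open>r\<^sup>=\<close> contains the diagonal of the whole type, so the partial order
  laws hold without carrier assumptions; only comparability, as in \<open>not_le\<close>, needs
  them.\<close>

sublocale ordering le lt
  using lt_trans lt_irrefl by unfold_locales auto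

lemma not_le: "x \<in> carrier X \<Longrightarrow> y \<in> carrier X \<Longrightarrow> \<not> x \<preceq> y \<longleftrightarrow> y \<prec> x"
  using lt_total lt_trans lt_irrefl by blast

lemma lt_inv_mult: "g \<in> carrier X \<Longrightarrow> y \<in> carrier X \<Longrightarrow> g \<prec> y \<Longrightarrow> \<one> \<prec> inv g \<otimes> y"
  using mult_lt[of "inv g" g y] by simp

text \<open>\<open>inv x \<otimes> y\<close> is a positive element of \<open>S\<close>, hence at
  least \<open>e\<close>; left multiplication by \<open>x\<close> gives the bound. The subgroup
  \<open>S\<close> will be one of \<open>A\<close>, \<open>G\<close>, \<open>H\<close>.\<close>

lemma mult_min_positive_le:
  assumes S: "subgroup S X" and e: "\<And>s. s \<in> S \<Longrightarrow> \<one> \<prec> s \<Longrightarrow> e \<preceq> s" "e \<in> S"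
    and "x \<in> S" "y \<in> S" "x \<prec> y"
  shows "x \<otimes> e \<preceq> y"
proof -
  have x: "x \<in> carrier X" and y: "y \<in> carrier X"
    using assms subgroup.mem_carrier by metis+
  have "e \<preceq> inv x \<otimes> y"
    using assms lt_inv_mult[OF x y] by (simp add: subgroup.m_inv_closed subgroup.m_closed)
  from mult_le[OF x this] x y show ?thesis by (simp add: inv_solve_left m_assoc[symmetric])
qed

text \<open>Right multiplication by \<open>inv e\<close> need not preserve the order, so the bound
  comes by contradiction: from \<open>y \<otimes> inv e \<prec> x\<close> in \<open>S\<close> the
  previous bound would give \<open>y \<preceq> x\<close>.\<close>

lemma le_mult_inv_min_positive:
  assumes S: "subgroup S X" and e: "\<And>s. s \<in> S \<Longrightarrow> \<one> \<prec> s \<Longrightarrow> e \<preceq> s" "e \<in> S"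
    and "x \<in> S" "y \<in> S" "x \<prec> y"
  shows "x \<preceq> y \<otimes> inv e"
proof (rule ccontr)
  have c: "x \<in> carrier X" "y \<in> carrier X" "e \<in> carrier X"
    using assms subgroup.mem_carrier by metis+
  assume "\<not> ?thesis"
  then have "y \<otimes> inv e \<prec> x" using c by (subst (asm) not_le) auto
  moreover have "y \<otimes> inv e \<in> S"
    using assms by (simp add: subgroup.m_inv_closed subgroup.m_closed)
  ultimately have "y \<otimes> inv e \<otimes> e \<preceq> x"
    using assms(4) by (intro mult_min_positive_le[OF S e])
  then have "y \<preceq> x" using c by (simp add: m_assoc)
  then show False using \<open>x \<prec> y\<close> strict_trans1 lt_irrefl by blast
qed

text \<open>The hull equals the subgroup generated by the two smaller hulls: one inclusion is
  \<open>gen\<close>, the other holds since both smaller hulls act on the large one by left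
  multiplication.\<close>

lemma Conv_generated_subgroup:
  assumes S: "subgroup S X" and T: "subgroup T X"
    and B: "subgroup B X" "B \<subseteq> S" "B \<subseteq> T"
    and CS: "subgroup (Conv S r B) X" and CT: "subgroup (Conv T r B) X"
    and gen: "Conv (carrier X) r B \<subseteq> generate X (Conv S r B \<union> Conv T r B)"
  shows "subgroup (Conv (carrier X) r B) X"
proof -
  let ?K = "Conv (carrier X) r B" and ?L = "generate X (Conv S r B \<union> Conv T r B)"
  \<comment> \<open>For \<open>b \<preceq> x \<preceq> b'\<close> the products
    \<open>u \<otimes> b\<close> and \<open>u \<otimes> b'\<close> stay in the subgroup
    \<open>Conv U r B\<close>, so elements of \<open>B\<close> bound them, and left invariance
    encloses \<open>u \<otimes> x\<close>.\<close>
  have step: "u \<otimes> x \<in> ?K" if u': "u \<in> Conv U r B" and x': "x \<in> ?K" and "subgroup (Conv U r B) X" "B \<subseteq> U" for U u x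
  proof -
    have u: "u \<in> carrier X" using that subgroup.mem_carrier by metis
    obtain b b' where b: "b \<in> B" "b' \<in> B" "b \<preceq> x" "x \<preceq> b'" and x: "x \<in> carrier X"
      using x' unfolding Conv_def mem_Collect_eq by metis
    have "B \<subseteq> Conv U r B" using \<open>B \<subseteq> U\<close> by (auto simp: Conv_def)
    then have "u \<otimes> b \<in> Conv U r B" "u \<otimes> b' \<in> Conv U r B"
      using that b by (auto intro: subgroup.m_closed)
    then obtain c c' where "c \<in> B" "c' \<in> B" "c \<preceq> u \<otimes> b" "u \<otimes> b' \<preceq> c'"
      by (auto simp: Conv_def)
    moreover have "u \<otimes> b \<preceq> u \<otimes> x" "u \<otimes> x \<preceq> u \<otimes> b'"
      using b(3,4) u mult_le by metis+
    ultimately have "c \<in> B" "c' \<in> B" "c \<preceq> u \<otimes> x" "u \<otimes> x \<preceq> c'"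
      using trans by metis+
    moreover have "u \<otimes> x \<in> carrier X" using u x by simp
    ultimately show ?thesis unfolding Conv_def mem_Collect_eq by metis
  qed
  have one: "\<one> \<in> ?K" using subgroup.one_closed[OF B(1)] by (auto simp: Conv_def)
  have sub: "Conv S r B \<union> Conv T r B \<subseteq> carrier X"
    using subgroup.subset[OF CS] subgroup.subset[OF CT] by blast
  have gens: "u \<otimes> x \<in> ?K" if "u \<in> Conv S r B \<union> Conv T r B" "x \<in> ?K" for u x
    using that step[OF _ _ CS B(2)] step[OF _ _ CT B(3)] by blast
  have act: "u \<in> ?L \<Longrightarrow> x \<in> ?K \<Longrightarrow> u \<otimes> x \<in> ?K" for u x
  proof (induction arbitrary: x rule: generate.induct)
    case one
    then show ?case by (simp add: Conv_def)
  next
    case (incl u)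
    then show ?case using gens by blast
  next
    case (inv u)
    then have "inv u \<in> Conv S r B \<union> Conv T r B"
      using subgroup.m_inv_closed[OF CS] subgroup.m_inv_closed[OF CT] by blast
    then show ?case using gens inv.prems by blast
  next
    case (eng u v)
    moreover have "u \<in> carrier X" "v \<in> carrier X" "x \<in> carrier X"
      using eng generate_in_carrier[OF sub] by (auto simp: Conv_def)
    ultimately show ?case by (simp add: m_assoc)
  qed
  \<comment> \<open>Each generated element is its own product with \<open>\<one>\<close>, which lies
    in \<open>?K\<close>.\<close>
  have "?L \<subseteq> ?K"
    using act[OF _ one] generate_in_carrier[OF sub] by fastforce
  with gen have "?K = ?L" by blast
  then show ?thesis using generate_is_subgroup[OF sub] by simp
qed

end

text \<open>\<open>\<alpha> \<otimes> inv \<eta>\<close> is the largest element of \<open>H\<close> below \<open>\<alpha>\<close>, so \<open>gap\<close> says that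
  within the interval from \<open>\<one>\<close> to \<open>\<alpha>\<close> all elements of \<open>H\<close> lie below all nontrivial
  elements of \<open>G\<close>.\<close>

locale stepping_amalgam = left_ordered_group +
  fixes A G H and \<alpha> \<gamma> \<eta>
  assumes A: "subgroup A X" and G: "subgroup G X" and H: "subgroup H X"
    and AG: "A \<subseteq> G" and AH: "A \<subseteq> H"
    and generated: "generate X (G \<union> H) = carrier X"
    and \<alpha>: "\<alpha> \<in> A" "\<one> \<prec> \<alpha>" "\<And>s. s \<in> A \<Longrightarrow> \<one> \<prec> s \<Longrightarrow> \<alpha> \<preceq> s"
    and \<gamma>: "\<gamma> \<in> G" "\<And>s. s \<in> G \<Longrightarrow> \<one> \<prec> s \<Longrightarrow> \<gamma> \<preceq> s"
    and \<eta>: "\<eta> \<in> H" "\<And>s. s \<in> H \<Longrightarrow> \<one> \<prec> s \<Longrightarrow> \<eta> \<preceq> s"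
    and floor: "\<And>x. x \<in> G \<union> H \<Longrightarrow> \<exists>a\<in>A. a \<preceq> x \<and> x \<prec> a \<otimes> \<alpha>"
    and gap: "\<alpha> \<otimes> inv \<eta> \<prec> \<gamma>"
begin

section \<open>Alternating words in \<open>G\<close> and \<open>H\<close>\<close>

text \<open>Elements of \<open>X\<close> with some alternating expression whose first letter lies in
  \<open>G - A\<close> or in \<open>H - A\<close> respectively. Uniqueness of such expressions is
  not asserted; the mutual induction takes the place of induction on the word length.\<close>

inductive_set G_words and H_words where
  G_base: "g \<in> G - A \<Longrightarrow> g \<in> G_words"
| G_step: "g \<in> G - A \<Longrightarrow> z \<in> H_words \<Longrightarrow> g \<otimes> z \<in> G_words"
| H_base: "h \<in> H - A \<Longrightarrow> h \<in> H_words"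
| H_step: "h \<in> H - A \<Longrightarrow> z \<in> G_words \<Longrightarrow> h \<otimes> z \<in> H_words"

lemmas G_carrier = subgroup.mem_carrier[OF G] and H_carrier = subgroup.mem_carrier[OF H]
  and A_carrier = subgroup.mem_carrier[OF A]

text \<open>Otherwise cancelling \<open>a\<close> by \<open>inv a \<in> A\<close> would put
  \<open>s\<close> into \<open>A\<close>.\<close>

lemma diff_mult:
  assumes "subgroup S X" "A \<subseteq> S" "a \<in> A" "s \<in> S - A"
  shows "a \<otimes> s \<in> S - A" "s \<otimes> a \<in> S - A"
proof -
  have c: "a \<in> carrier X" "s \<in> carrier X"
    using assms A_carrier subgroup.mem_carrier[OF assms(1)] by auto
  have S: "a \<otimes> s \<in> S" "s \<otimes> a \<in> S"
    using assms by (auto intro: subgroup.m_closed)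
  have "inv a \<otimes> (a \<otimes> s) = s" "s \<otimes> a \<otimes> inv a = s"
    using c by (simp_all add: m_assoc[symmetric], simp add: m_assoc)
  moreover have "inv a \<in> A" using assms A by (simp add: subgroup.m_inv_closed)
  ultimately show "a \<otimes> s \<in> S - A" "s \<otimes> a \<in> S - A"
    using S assms(4) subgroup.m_closed[OF A] by (metis DiffD2 DiffI)+
qed

lemma words_carrier: "z \<in> G_words \<Longrightarrow> z \<in> carrier X" "z \<in> H_words \<Longrightarrow> z \<in> carrier X"
  by (induction rule: G_words_H_words.inducts) (auto simp: G_carrier H_carrier)

text \<open>The factor from \<open>A\<close> is absorbed into the first letter, which stays outside
  \<open>A\<close>.\<close>

lemma A_mult_words:
  assumes "a \<in> A"
  shows "z \<in> G_words \<Longrightarrow> a \<otimes> z \<in> G_words" "z \<in> H_words \<Longrightarrow> a \<otimes> z \<in> H_words"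
proof -
  show "a \<otimes> z \<in> G_words" if "z \<in> G_words"
    using that
  proof cases
    case G_base
    then show ?thesis using diff_mult(1)[OF G AG assms] by (auto intro: G_words_H_words.intros)
  next
    case (G_step g w)
    then have "a \<otimes> z = a \<otimes> g \<otimes> w"
      using assms by (simp add: m_assoc A_carrier G_carrier words_carrier)
    then show ?thesis using diff_mult(1)[OF G AG assms] G_step
      by (auto intro: G_words_H_words.intros)
  qed
  show "a \<otimes> z \<in> H_words" if "z \<in> H_words"
    using that
  proof cases
    case H_base
    then show ?thesis using diff_mult(1)[OF H AH assms] by (auto intro: G_words_H_words.intros)
  next
    case (H_step h w)
    then have "a \<otimes> z = a \<otimes> h \<otimes> w"
      using assms by (simp add: m_assoc A_carrier H_carrier words_carrier)
    then show ?thesis using diff_mult(1)[OF H AH assms] H_step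
      by (auto intro: G_words_H_words.intros)
  qed
qed

text \<open>For \<open>g\<close> outside \<open>A\<close>: it is prepended if the word starts in
  \<open>H\<close>, and otherwise merged with the first letter; if the merged letter falls into
  \<open>A\<close>, the word after it absorbs it.\<close>

lemma G_mult_words:
  assumes "g \<in> G" "z \<in> A \<union> G_words \<union> H_words"
  shows "g \<otimes> z \<in> A \<union> G_words \<union> H_words"
proof (cases "g \<in> A")
  case True
  then show ?thesis using A_mult_words assms(2) subgroup.m_closed[OF A] by blast
next
  case False
  have *: "u \<in> A \<union> G_words" if "u \<in> G" for u
    using that by (auto intro: G_words_H_words.intros)
  consider "z \<in> G" | u w where "z = u \<otimes> w" "u \<in> G" "w \<in> H_words" | "z \<in> H_words"
    using assms(2) AG by (auto elim: G_words.cases)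
  then show ?thesis
  proof cases
    case 1
    then show ?thesis using * assms(1) G by (blast intro: subgroup.m_closed)
  next
    case 2
    then have "g \<otimes> z = (g \<otimes> u) \<otimes> w" and "g \<otimes> u \<in> G"
      using assms(1) G by (simp_all add: m_assoc G_carrier words_carrier subgroup.m_closed)
    then show ?thesis
      using 2 A_mult_words(2)[of "g \<otimes> u" w] by (auto intro: G_words_H_words.intros)
  next
    case 3
    then show ?thesis using False assms(1) by (auto intro: G_words_H_words.intros)
  qed
qed

lemma H_mult_words:
  assumes "h \<in> H" "z \<in> A \<union> G_words \<union> H_words"
  shows "h \<otimes> z \<in> A \<union> G_words \<union> H_words"
proof (cases "h \<in> A")
  case True
  then show ?thesis using A_mult_words assms(2) subgroup.m_closed[OF A] by blast
next
  case False
  have *: "u \<in> A \<union> H_words" if "u \<in> H" for u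
    using that by (auto intro: G_words_H_words.intros)
  consider "z \<in> H" | u w where "z = u \<otimes> w" "u \<in> H" "w \<in> G_words" | "z \<in> G_words"
    using assms(2) AH by (auto elim: H_words.cases)
  then show ?thesis
  proof cases
    case 1
    then show ?thesis using * assms(1) H by (blast intro: subgroup.m_closed)
  next
    case 2
    then have "h \<otimes> z = (h \<otimes> u) \<otimes> w" and "h \<otimes> u \<in> H"
      using assms(1) H by (simp_all add: m_assoc H_carrier words_carrier subgroup.m_closed)
    then show ?thesis
      using 2 A_mult_words(1)[of "h \<otimes> u" w] by (auto intro: G_words_H_words.intros)
  next
    case 3
    then show ?thesis using False assms(1) by (auto intro: G_words_H_words.intros)
  qed
qed

text \<open>The union of the three sets contains \<open>\<one>\<close> and is stable under left
  multiplication by the generators, so it contains \<open>x \<otimes> \<one>\<close>.\<close>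

lemma carrier_words: "carrier X \<subseteq> A \<union> G_words \<union> H_words"
proof
  let ?W = "A \<union> G_words \<union> H_words"
  fix x assume "x \<in> carrier X"
  then have "x \<in> generate X (G \<union> H)" by (simp add: generated)
  then have act: "z \<in> ?W \<Longrightarrow> x \<otimes> z \<in> ?W" for z
  proof (induction arbitrary: z rule: generate.induct)
    case one
    then show ?case using A_carrier words_carrier by auto
  next
    case (incl u)
    then show ?case using G_mult_words H_mult_words by blast
  next
    case (inv u)
    then show ?case
      using G_mult_words H_mult_words subgroup.m_inv_closed[OF G] subgroup.m_inv_closed[OF H] by blast
  next
    case (eng u v)
    then have "u \<in> carrier X" "v \<in> carrier X" by (simp_all add: generated)
    moreover have "z \<in> carrier X" using eng.prems A_carrier words_carrier by auto
    ultimately show ?case using eng by (simp add: m_assoc)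
  qed
  show "x \<in> ?W"
    using act[of \<one>] \<open>x \<in> carrier X\<close> subgroup.one_closed[OF A] by auto
qed

section \<open>Position of alternating words relative to \<open>A\<close>\<close>

lemma strict_floor:
  assumes "x \<in> (G \<union> H) - A"
  obtains a where "a \<in> A" "a \<prec> x" "x \<prec> a \<otimes> \<alpha>"
  using floor[of x] assms by auto

text \<open>\<open>a\<close>, \<open>k\<close> and \<open>a \<otimes> \<alpha>\<close> all lie in
  \<open>H\<close>, so in a strict inequality between two of them the larger one may be replaced by
  its predecessor in \<open>H\<close>, obtained by right multiplication with
  \<open>inv \<eta>\<close>.\<close>

lemma H_floor:
  assumes "k \<in> H - A"
  obtains a where "a \<in> A" "a \<preceq> k \<otimes> inv \<eta>" "a \<prec> k" "k \<preceq> a \<otimes> (\<alpha> \<otimes> inv \<eta>)" "k \<prec> a \<otimes> \<alpha>"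
proof -
  obtain a where a: "a \<in> A" "a \<prec> k" "k \<prec> a \<otimes> \<alpha>" using strict_floor[of k] assms by auto
  moreover have "a \<in> H" "k \<in> H" "a \<otimes> \<alpha> \<in> H"
    using a(1) assms AH \<alpha>(1) subgroup.m_closed[OF A] by auto
  ultimately have "a \<preceq> k \<otimes> inv \<eta>" "k \<preceq> (a \<otimes> \<alpha>) \<otimes> inv \<eta>"
    by - (rule le_mult_inv_min_positive[OF H \<eta>(2,1)]; assumption)+
  then show ?thesis using that[of a] a A_carrier \<alpha>(1) H_carrier \<eta>(1) by (simp add: m_assoc)
qed

text \<open>As for \<open>H\<close>, but here the smaller side of a strict inequality is replaced by
  its successor in \<open>G\<close>, obtained by right multiplication with
  \<open>\<gamma>\<close>.\<close>

lemma G_floor: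
  assumes "k \<in> G - A"
  obtains a where "a \<in> A" "a \<otimes> \<gamma> \<preceq> k" "a \<prec> k" "k \<otimes> \<gamma> \<preceq> a \<otimes> \<alpha>" "k \<prec> a \<otimes> \<alpha>"
proof -
  obtain a where a: "a \<in> A" "a \<prec> k" "k \<prec> a \<otimes> \<alpha>" using strict_floor[of k] assms by auto
  moreover have "a \<in> G" "k \<in> G" "a \<otimes> \<alpha> \<in> G"
    using a(1) assms AG \<alpha>(1) subgroup.m_closed[OF A] by auto
  ultimately have "a \<otimes> \<gamma> \<preceq> k" "k \<otimes> \<gamma> \<preceq> a \<otimes> \<alpha>"
    by - (rule mult_min_positive_le[OF G \<gamma>(2,1)]; assumption)+
  then show ?thesis using that[of a] a by blast
qed

text \<open>The two bounds of an \<open>H\<close>-word are neighbours in \<open>G\<close>, those of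
  a \<open>G\<close>-word are neighbours in \<open>H\<close>. A new first letter from that group
  moves them to neighbours again, whose floor in \<open>A\<close>, together with \<open>gap\<close>,
  gives the bounds of the longer word.\<close>

lemma word_position:
  shows "z \<in> G_words \<Longrightarrow> \<exists>a\<in>A. a \<otimes> (\<alpha> \<otimes> inv \<eta>) \<prec> z \<and> z \<prec> a \<otimes> \<alpha>"
    and "z \<in> H_words \<Longrightarrow> \<exists>a\<in>A. a \<prec> z \<and> z \<prec> a \<otimes> \<gamma>"
proof (induction rule: G_words_H_words.inducts)
  case (G_base g)
  then obtain a where a: "a \<in> A" "a \<otimes> \<gamma> \<preceq> g" "g \<prec> a \<otimes> \<alpha>" by (rule G_floor)
  then show ?case using mult_lt[OF A_carrier gap] strict_trans2 by blast
next
  case (G_step g z)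
  then obtain a where a: "a \<in> A" "a \<prec> z" "z \<prec> a \<otimes> \<gamma>" by blast
  \<comment> \<open>\<open>g \<otimes> a\<close> and \<open>g \<otimes> a \<otimes> \<gamma>\<close>
    are consecutive in \<open>G\<close> and enclose \<open>g \<otimes> z\<close>.\<close>
  have k: "g \<otimes> a \<in> G - A" using diff_mult(2)[OF G AG] a G_step by blast
  then obtain b where b: "b \<in> A" "b \<otimes> \<gamma> \<preceq> g \<otimes> a" "g \<otimes> a \<otimes> \<gamma> \<preceq> b \<otimes> \<alpha>" by (rule G_floor)
  have c: "g \<in> carrier X" using G_carrier G_step by blast
  have "g \<otimes> a \<prec> g \<otimes> z" "g \<otimes> z \<prec> g \<otimes> a \<otimes> \<gamma>"
    using mult_lt[OF c a(2)] mult_lt[OF c a(3)] c a(1) \<gamma>(1) A_carrier G_carrier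
    by (simp_all add: m_assoc)
  then show ?case
    using b mult_lt[OF A_carrier gap] by (meson strict_trans strict_trans1 strict_trans2)
next
  case (H_base h)
  then obtain a where a: "a \<in> A" "a \<prec> h" "h \<preceq> a \<otimes> (\<alpha> \<otimes> inv \<eta>)" by (rule H_floor)
  then show ?case using mult_lt[OF A_carrier gap] strict_trans1 by blast
next
  case (H_step h z)
  then obtain a where a: "a \<in> A" "a \<otimes> (\<alpha> \<otimes> inv \<eta>) \<prec> z" "z \<prec> a \<otimes> \<alpha>" by blast
  \<comment> \<open>\<open>z\<close> lies just below \<open>a \<otimes> \<alpha>\<close>, so the
    floor is taken of this product and not of \<open>h \<otimes> a\<close>;
    \<open>h \<otimes> z\<close> lies between it and its predecessor in \<open>H\<close>.\<close>
  have k: "h \<otimes> (a \<otimes> \<alpha>) \<in> H - A"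
    using diff_mult(2)[OF H AH] a H_step \<alpha>(1) subgroup.m_closed[OF A] by blast
  then obtain b where b: "b \<in> A" "b \<preceq> h \<otimes> (a \<otimes> \<alpha>) \<otimes> inv \<eta>"
      "h \<otimes> (a \<otimes> \<alpha>) \<preceq> b \<otimes> (\<alpha> \<otimes> inv \<eta>)" by (rule H_floor)
  have c: "h \<in> carrier X" using H_carrier H_step by blast
  have "h \<otimes> (a \<otimes> \<alpha>) \<otimes> inv \<eta> \<prec> h \<otimes> z" "h \<otimes> z \<prec> h \<otimes> (a \<otimes> \<alpha>)"
    using mult_lt[OF c a(2)] mult_lt[OF c a(3)] c a(1) \<alpha>(1) \<eta>(1) A_carrier H_carrier
    by (simp_all add: m_assoc)
  then show ?case
    using b mult_lt[OF A_carrier gap] by (meson strict_trans strict_trans1 strict_trans2)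
qed

section \<open>The convex hull of \<open>B\<close> in \<open>X\<close>\<close>

text \<open>This is the case of a nontrivial \<open>B\<close>: a positive element of
  \<open>B\<close> is at least \<open>\<alpha>\<close>, so convexity in \<open>A\<close> forces
  \<open>\<alpha> \<in> B\<close>.\<close>

context
  fixes B
  assumes B: "subgroup B X" "B \<subseteq> A" and convex: "order_convex A r B" and \<alpha>B: "\<alpha> \<in> B"
    and CG: "subgroup (Conv G r B) X" and CH: "subgroup (Conv H r B) X"
begin

text \<open>No element of \<open>A\<close> lies strictly between \<open>a\<close> and
  \<open>a \<otimes> \<alpha>\<close>, so a lower bound of \<open>x\<close> in \<open>B\<close> is
  at most \<open>a\<close>, while an upper bound of \<open>x\<close> in \<open>B\<close> is at least
  \<open>a\<close>. Convexity of \<open>B\<close> in \<open>A\<close> then applies.\<close>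

lemma floor_in_Conv:
  assumes "x \<in> Conv (carrier X) r B" "a \<in> A" "a \<preceq> x" "x \<prec> a \<otimes> \<alpha>"
  shows "a \<in> B" "a \<otimes> \<alpha> \<in> B"
proof -
  obtain b b' where b: "b \<in> B" "b' \<in> B" "b \<preceq> x" "x \<preceq> b'"
    using assms by (auto simp: Conv_def)
  have "b \<prec> a \<otimes> \<alpha>" using b assms strict_trans1 by blast
  have "b \<preceq> a"
  proof (rule ccontr)
    assume "\<not> ?thesis"
    then have "a \<prec> b" using assms(2) b(1) B A_carrier by (subst (asm) not_le) auto
    then have "a \<otimes> \<alpha> \<preceq> b"
      using assms(2) b(1) B by (intro mult_min_positive_le[OF A \<alpha>(3,1)]) auto
    then show False using \<open>b \<prec> a \<otimes> \<alpha>\<close> strict_trans1 lt_irrefl by blast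
  qed
  moreover have "a \<preceq> b'" using b assms trans by blast
  ultimately show "a \<in> B"
    using b(1,2) assms(2) convex unfolding order_convex_def by blast
  then show "a \<otimes> \<alpha> \<in> B" using \<alpha>B B by (simp add: subgroup.m_closed)
qed

text \<open>The factor \<open>c\<close> is part of the induction because the correction of the first
  letter is passed on: the corrected letter lies in a small hull, and the inverse of the correcting
  element is multiplied to the remainder, to which the induction hypothesis applies.\<close>

lemma word_in_Conv:
  shows "z \<in> G_words \<Longrightarrow> \<forall>c\<in>A. c \<otimes> z \<in> Conv (carrier X) r B \<longrightarrow>
      c \<otimes> z \<in> generate X (Conv G r B \<union> Conv H r B)"
    and "z \<in> H_words \<Longrightarrow> \<forall>c\<in>A. c \<otimes> z \<in> Conv (carrier X) r B \<longrightarrow>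
      c \<otimes> z \<in> generate X (Conv G r B \<union> Conv H r B)"
proof (induction rule: G_words_H_words.inducts)
  case (G_base g)
  \<comment> \<open>A single letter needs no splitting: an element of \<open>G\<close> enclosed by
    \<open>B\<close> in \<open>X\<close> is enclosed by \<open>B\<close> in
    \<open>G\<close>.\<close>
  then show ?case
    using diff_mult(1)[OF G AG] by (auto simp: Conv_def intro!: generate.incl)
next
  case (G_step g z)
  show ?case
  proof (intro ballI impI)
    fix c assume c: "c \<in> A" "c \<otimes> (g \<otimes> z) \<in> Conv (carrier X) r B"
    obtain a where a: "a \<in> A" "a \<prec> z" "z \<prec> a \<otimes> \<gamma>"
      using word_position(2) G_step by blast
    \<comment> \<open>As \<open>z\<close> lies just above \<open>a\<close>, this is the element of
      \<open>G\<close> just below the whole product; the remainder \<open>inv a \<otimes> z\<close>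
      lies between \<open>\<one>\<close> and \<open>\<gamma>\<close>.\<close>
    define k where "k = c \<otimes> g \<otimes> a"
    have cg: "c \<otimes> g \<in> G - A" using diff_mult(1)[OF G AG] c(1) G_step by blast
    then have k: "k \<in> G - A" using diff_mult(2)[OF G AG] a(1) by (simp add: k_def)
    then obtain b where b: "b \<in> A" "b \<otimes> \<gamma> \<preceq> k" "b \<prec> k" "k \<otimes> \<gamma> \<preceq> b \<otimes> \<alpha>" "k \<prec> b \<otimes> \<alpha>"
      by (rule G_floor)
    have car: "c \<in> carrier X" "g \<in> carrier X" "a \<in> carrier X" "z \<in> carrier X" "k \<in> carrier X"
      "\<gamma> \<in> carrier X" "c \<otimes> g \<in> carrier X"
      using c(1) a(1) k cg G_step \<gamma>(1) A_carrier G_carrier words_carrier by auto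
    have eq: "c \<otimes> (g \<otimes> z) = k \<otimes> (inv a \<otimes> z)"
      using car by (simp add: k_def m_assoc) (simp add: m_assoc[symmetric])
    have z: "\<one> \<prec> inv a \<otimes> z" "inv a \<otimes> z \<prec> \<gamma>"
      using mult_lt[OF inv_closed[OF car(3)] a(2)] mult_lt[OF inv_closed[OF car(3)] a(3)] car
      by (simp_all add: m_assoc[symmetric])
    have "k \<prec> c \<otimes> (g \<otimes> z)" "c \<otimes> (g \<otimes> z) \<prec> b \<otimes> \<alpha>"
      using mult_lt[OF car(5) z(1)] mult_lt[OF car(5) z(2)] car b(4) strict_trans2
      unfolding eq by auto
    \<comment> \<open>The floor of \<open>k\<close> in \<open>A\<close> is also the floor of the
      whole product, which lies in the hull.\<close>
    then have bB: "b \<in> B" "b \<otimes> \<alpha> \<in> B"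
      using floor_in_Conv[OF c(2) b(1)] b(3) lt_trans by blast+
    then have "k \<in> Conv G r B" using k b(3,5) by (auto simp: Conv_def)
    \<comment> \<open>Hence the remainder is enclosed by \<open>\<one>\<close> and
      \<open>\<alpha>\<close>, both in \<open>B\<close>.\<close>
    moreover have "\<gamma> \<preceq> \<alpha>" using \<gamma>(2)[OF _ \<alpha>(2)] \<alpha>(1) AG by blast
    then have "inv a \<otimes> z \<in> Conv (carrier X) r B"
      using z car \<alpha>B subgroup.one_closed[OF B(1)] strict_trans2[OF z(2)]
      by (auto simp: Conv_def)
    then have "inv a \<otimes> z \<in> generate X (Conv G r B \<union> Conv H r B)"
      using G_step.IH subgroup.m_inv_closed[OF A a(1)] by blast
    ultimately show "c \<otimes> (g \<otimes> z) \<in> generate X (Conv G r B \<union> Conv H r B)"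
      unfolding eq by (auto intro: generate.eng generate.incl)
  qed
next
  case (H_base h)
  then show ?case
    using diff_mult(1)[OF H AH] by (auto simp: Conv_def intro!: generate.incl)
next
  case (H_step h z)
  show ?case
  proof (intro ballI impI)
    fix c assume c: "c \<in> A" "c \<otimes> (h \<otimes> z) \<in> Conv (carrier X) r B"
    obtain a where a: "a \<in> A" "a \<otimes> (\<alpha> \<otimes> inv \<eta>) \<prec> z" "z \<prec> a \<otimes> \<alpha>"
      using word_position(1) H_step by blast
    \<comment> \<open>Here \<open>z\<close> lies just below \<open>a \<otimes> \<alpha>\<close>, so
      this element is the correction; the remainder lies between \<open>inv \<eta>\<close> and
      \<open>\<one>\<close>.\<close>
    define k where "k = c \<otimes> h \<otimes> (a \<otimes> \<alpha>)"
    have a\<alpha>: "a \<otimes> \<alpha> \<in> A" using a(1) \<alpha>(1) A by (simp add: subgroup.m_closed)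
    have ch: "c \<otimes> h \<in> H - A" using diff_mult(1)[OF H AH] c(1) H_step by blast
    then have k: "k \<in> H - A" using diff_mult(2)[OF H AH a\<alpha>] by (simp add: k_def)
    then obtain b where b: "b \<in> A" "b \<preceq> k \<otimes> inv \<eta>" "b \<prec> k" "k \<prec> b \<otimes> \<alpha>"
      by (rule H_floor)
    have car: "c \<in> carrier X" "h \<in> carrier X" "a \<in> carrier X" "z \<in> carrier X" "k \<in> carrier X"
      "\<eta> \<in> carrier X" "\<alpha> \<in> carrier X" "a \<otimes> \<alpha> \<in> carrier X"
      using c(1) a(1) k a\<alpha> H_step \<eta>(1) \<alpha>(1) A_carrier H_carrier words_carrier by auto
    have inv_eq: "inv (a \<otimes> \<alpha>) \<otimes> (a \<otimes> (\<alpha> \<otimes> inv \<eta>)) = inv \<eta>"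
      using car by (subst m_assoc[symmetric, of a]) (simp_all add: inv_solve_left')
    have eq: "c \<otimes> (h \<otimes> z) = k \<otimes> (inv (a \<otimes> \<alpha>) \<otimes> z)"
    proof -
      have "k \<otimes> (inv (a \<otimes> \<alpha>) \<otimes> z) = c \<otimes> h \<otimes> ((a \<otimes> \<alpha>) \<otimes> (inv (a \<otimes> \<alpha>) \<otimes> z))"
        using car by (simp add: k_def m_assoc)
      also have "(a \<otimes> \<alpha>) \<otimes> (inv (a \<otimes> \<alpha>) \<otimes> z) = z"
        using car by (subst m_assoc[symmetric, of "a \<otimes> \<alpha>"]) simp_all
      finally show ?thesis using car by (simp add: m_assoc)
    qed
    have z: "inv \<eta> \<prec> inv (a \<otimes> \<alpha>) \<otimes> z" "inv (a \<otimes> \<alpha>) \<otimes> z \<prec> \<one>"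
      using mult_lt[OF inv_closed[OF car(8)] a(2)] mult_lt[OF inv_closed[OF car(8)] a(3)] car
      unfolding inv_eq by simp_all
    have "k \<otimes> inv \<eta> \<prec> c \<otimes> (h \<otimes> z)" "c \<otimes> (h \<otimes> z) \<prec> k"
      using mult_lt[OF car(5) z(1)] mult_lt[OF car(5) z(2)] car unfolding eq by auto
    then have "b \<in> B" "b \<otimes> \<alpha> \<in> B"
      using floor_in_Conv[OF c(2) b(1)] b lt_trans strict_trans1 by blast+
    then have "k \<in> Conv H r B" using k b(3,4) by (auto simp: Conv_def)
    \<comment> \<open>Inversion need not reverse a left-ordering, so
      \<open>inv \<alpha> \<preceq> inv \<eta>\<close> is derived from the minimality of
      \<open>\<eta>\<close> in \<open>H\<close> and not from
      \<open>\<eta> \<preceq> \<alpha>\<close>. It encloses the remainder by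
      \<open>inv \<alpha>\<close> and \<open>\<one>\<close>, both in \<open>B\<close>.\<close>
    moreover have "\<one> \<preceq> \<alpha> \<otimes> inv \<eta>"
      using le_mult_inv_min_positive[OF H \<eta>(2,1) subgroup.one_closed[OF H] _ \<alpha>(2)] \<alpha>(1) AH by blast
    then have "inv \<alpha> \<preceq> inv \<eta>"
      using mult_le[of "inv \<alpha>" \<one> "\<alpha> \<otimes> inv \<eta>"] car by (simp add: m_assoc[symmetric])
    then have "inv \<alpha> \<prec> inv (a \<otimes> \<alpha>) \<otimes> z" using z(1) strict_trans1 by blast
    then have "inv (a \<otimes> \<alpha>) \<otimes> z \<in> Conv (carrier X) r B"
      using z(2) lt_closed subgroup.m_inv_closed[OF B(1) \<alpha>B] subgroup.one_closed[OF B(1)]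
      unfolding Conv_def by blast
    then have "inv (a \<otimes> \<alpha>) \<otimes> z \<in> generate X (Conv G r B \<union> Conv H r B)"
      using H_step.IH subgroup.m_inv_closed[OF A a\<alpha>] by blast
    ultimately show "c \<otimes> (h \<otimes> z) \<in> generate X (Conv G r B \<union> Conv H r B)"
      unfolding eq by (auto intro: generate.eng generate.incl)
  qed
qed

lemma Conv_subset_generate:
  "Conv (carrier X) r B \<subseteq> generate X (Conv G r B \<union> Conv H r B)"
proof
  fix x assume x: "x \<in> Conv (carrier X) r B"
  then have c: "x \<in> carrier X" by (simp add: Conv_def)
  then consider "x \<in> A" | "x \<in> G_words" | "x \<in> H_words" using carrier_words by blast
  then show "x \<in> generate X (Conv G r B \<union> Conv H r B)"
  proof cases
    case 1
    then have "x \<in> Conv G r B" using x AG by (auto simp: Conv_def)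
    then show ?thesis by (auto intro: generate.incl)
  qed (use word_in_Conv subgroup.one_closed[OF A] x c in force)+
qed

end

theorem Conv_subgroup:
  assumes B: "subgroup B X" "B \<subseteq> A" and convex: "order_convex A r B"
    and CG: "subgroup (Conv G r B) X" and CH: "subgroup (Conv H r B) X"
  shows "subgroup (Conv (carrier X) r B) X"
\<comment> \<open>The trivial subgroup does not contain \<open>\<alpha>\<close>; its hull is trivial
  by antisymmetry.\<close>
proof (cases "B = {\<one>}")
  case True
  then have "Conv (carrier X) r B = {\<one>}"
    using lt_irrefl lt_trans by (auto simp: Conv_def)
  then show ?thesis using triv_subgroup by simp
next
  case False
  then obtain b where b: "b \<in> B" "b \<noteq> \<one>" using subgroup.one_closed[OF B(1)] by blast
  have bc: "b \<in> carrier X" using b B A_carrier by blast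
  obtain b' where b': "b' \<in> B" "\<one> \<prec> b'"
  proof -
    from lt_total[OF bc one_closed] b consider "\<one> \<prec> b" | "b \<prec> \<one>" by blast
    then show ?thesis
    proof cases
      case 2
      then show ?thesis
        using that[of "inv b"] lt_inv_mult[OF bc one_closed] bc b B
        by (simp add: subgroup.m_inv_closed)
    qed (use that b in blast)
  qed
  then have "\<alpha> \<preceq> b'" using \<alpha>(3) B by blast
  then have "\<alpha> \<in> B"
    using b' \<alpha>(1,2) convex subgroup.one_closed[OF B(1)] unfolding order_convex_def by blast
  then show ?thesis
    using Conv_generated_subgroup[OF G H B(1) _ _ CG CH] Conv_subset_generate[OF assms(1-3) _ CG CH]
      B AG AH by blast
qed

end


section \<open>Generation of the amalgam by its factors\<close>

text \<open>The class of a word is the product of the classes of its letters.\<close>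

lemma (in amalgam_data) generate_amalgam:
  "generate X (amalgam_inl G H A i j ` carrier G \<union> amalgam_inr G H A i j ` carrier H) = carrier X"
  (is "generate X ?S = _")
proof
  interpret X: group X by (rule amalgam_group)
  show "generate X ?S \<subseteq> carrier X"
    using hom_carrier[OF amalgam_inl_hom] hom_carrier[OF amalgam_inr_hom]
    by (intro X.generate_incl) auto
  show "carrier X \<subseteq> generate X ?S"
  proof
    fix c assume "c \<in> carrier X"
    then obtain v where v: "v \<in> W" "c = E `` {v}" by (rule carrierE)
    have "v \<in> W \<Longrightarrow> E `` {v} \<in> generate X ?S"
    proof (induction v)
      case Nil
      then show ?case using generate.one[of X ?S] by (simp add: one_class)
    next
      case (Cons s w)
      then have s: "[s] \<in> W" "s \<in> carrier G <+> carrier H" and w: "w \<in> W" by auto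
      have "E `` {[s]} \<in> ?S"
        using s(2) by (cases s) (auto simp: amalgam_inl_def amalgam_inr_def)
      then have "E `` {[s]} \<otimes>\<^bsub>X\<^esub> E `` {w} \<in> generate X ?S"
        using Cons.IH[OF w] by (intro generate.eng) (rule generate.incl)
      then show ?case using mult_class[OF s(1) w] by simp
    qed
    with v show "c \<in> generate X ?S" by simp
  qed
qed

section \<open>Restricted orderings and order embeddings\<close>

lemma Res_comp: "f \<in> carrier A \<rightarrow> carrier G \<Longrightarrow> Res A (p \<circ> f) r = Res A f (Res G p r)"
  by (auto simp: Res_def)

text \<open>Injectivity of \<open>f\<close> makes the restriction total.\<close>

lemma left_ordering_Res:
  assumes A: "group A" and f: "f \<in> mon A G" and r: "left_ordering G r"
  shows "left_ordering A (Res A f r)"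
proof -
  have f': "f \<in> hom A G" "inj_on f (carrier A)" using f by (auto simp: mon_def)
  then have c: "f x \<in> carrier G" if "x \<in> carrier A" for x using that by (auto simp: hom_def)
  have r': "trans r" "irrefl r" "total_on (carrier G) r"
    and mult: "\<And>a b g. a \<in> carrier G \<Longrightarrow> b \<in> carrier G \<Longrightarrow> g \<in> carrier G \<Longrightarrow> (a, b) \<in> r \<Longrightarrow>
      (g \<otimes>\<^bsub>G\<^esub> a, g \<otimes>\<^bsub>G\<^esub> b) \<in> r"
    using r by (auto simp: left_ordering_def strict_linear_order_on_def)
  have "trans (Res A f r)"
    using r'(1) unfolding trans_def Res_def by blast
  moreover have "irrefl (Res A f r)"
    using r'(2) by (auto simp: irrefl_def Res_def)
  moreover have "total_on (carrier A) (Res A f r)"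
    using r'(3) c inj_on_eq_iff[OF f'(2)] by (auto simp: total_on_def Res_def)
  ultimately show ?thesis
    using A mult c f'(1)
    by (auto simp: left_ordering_def strict_linear_order_on_def Res_def hom_mult
        group.is_monoid monoid.m_closed)
qed

lemma subgroup_image:
  "group G \<Longrightarrow> group K \<Longrightarrow> f \<in> hom G K \<Longrightarrow> subgroup S G \<Longrightarrow> subgroup (f ` S) K"
  by (simp add: group_hom.subgroup_img_is_subgroup group_hom_axioms_def group_hom_def)

locale order_embedding =
  fixes G :: "('g, 'm) monoid_scheme" and X :: "('x, 'n) monoid_scheme" and p rG r
  assumes G: "group G" and X: "group X" and p: "p \<in> hom G X"
    and rG: "left_ordering G rG" and r: "left_ordering X r" and Res: "Res G p r = rG"
begin

interpretation G: left_ordered_group G rG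
  using G rG by (simp add: left_ordered_group_def left_ordered_group_axioms_def)
interpretation X: left_ordered_group X r
  using X r by (simp add: left_ordered_group_def left_ordered_group_axioms_def)

lemma lt_iff: "x \<in> carrier G \<Longrightarrow> y \<in> carrier G \<Longrightarrow> (p x, p y) \<in> r \<longleftrightarrow> (x, y) \<in> rG"
  using Res by (auto simp: Res_def)

text \<open>Distinct elements are comparable, so their images are strictly comparable and hence
  distinct. Thus the factors embed in the amalgam without a normal form theorem.\<close>

lemma embedding_inj: "inj_on p (carrier G)"
proof (rule inj_onI)
  fix x y assume xy: "x \<in> carrier G" "y \<in> carrier G" "p x = p y"
  then show "x = y"
    using G.lt_total[OF xy(1,2)] lt_iff[of x y] lt_iff[of y x] X.lt_irrefl[of "p y"] by auto
qed

lemma le_iff: "x \<in> carrier G \<Longrightarrow> y \<in> carrier G \<Longrightarrow> (p x, p y) \<in> r\<^sup>= \<longleftrightarrow> (x, y) \<in> rG\<^sup>="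
  using lt_iff inj_on_eq_iff[OF embedding_inj] by auto

lemma one_lt_iff: "y \<in> carrier G \<Longrightarrow> (\<one>\<^bsub>X\<^esub>, p y) \<in> r \<longleftrightarrow> (\<one>\<^bsub>G\<^esub>, y) \<in> rG"
  using lt_iff[of "\<one>\<^bsub>G\<^esub>" y] hom_one[OF p G X] by simp

text \<open>Carries hulls formed in \<open>G\<close> into \<open>X\<close>, so that the hypotheses
  on both factors can be combined inside one ordered group.\<close>

lemma Conv_image:
  assumes "B \<subseteq> carrier G"
  shows "Conv (p ` carrier G) r (p ` B) = p ` Conv (carrier G) rG B"
proof -
  have "p x \<in> Conv (p ` carrier G) r (p ` B) \<longleftrightarrow> x \<in> Conv (carrier G) rG B"
    if "x \<in> carrier G" for x
  proof -
    have "(p t, p x) \<in> r\<^sup>= \<longleftrightarrow> (t, x) \<in> rG\<^sup>=" "(p x, p t) \<in> r\<^sup>= \<longleftrightarrow> (x, t) \<in> rG\<^sup>="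
      if "t \<in> B" for t
      using le_iff assms \<open>x \<in> carrier G\<close> that by blast+
    then show ?thesis
      using that by (simp add: Conv_def del: Un_iff pair_in_Id_conv cong: bex_cong)
  qed
  moreover have "Conv (p ` carrier G) r (p ` B) \<subseteq> p ` carrier G" "Conv (carrier G) rG B \<subseteq> carrier G"
    by (simp_all add: Conv_def)
  ultimately show ?thesis by blast
qed

lemma subgroup_Conv_image:
  assumes "B \<subseteq> carrier G" "subgroup (Conv (carrier G) rG B) G"
  shows "subgroup (Conv (p ` carrier G) r (p ` B)) X"
  using assms by (simp add: Conv_image subgroup_image[OF G X p])

lemma order_convex_image:
  assumes "order_convex (carrier G) rG B"
  shows "order_convex (p ` carrier G) r (p ` B)"
  unfolding order_convex_def
proof (intro conjI ballI impI; (elim imageE conjE)?)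
  have B: "B \<subseteq> carrier G" using assms by (simp add: order_convex_def)
  then show "p ` B \<subseteq> p ` carrier G" by blast
  fix c c' s b b' x
  assume *: "(c, s) \<in> r\<^sup>=" "(s, c') \<in> r\<^sup>=" "c = p b" "b \<in> B" "c' = p b'" "b' \<in> B"
    "s = p x" "x \<in> carrier G"
  then have "(b, x) \<in> rG\<^sup>=" "(x, b') \<in> rG\<^sup>="
    using B le_iff by (metis subsetD)+
  then have "x \<in> B" using assms * unfolding order_convex_def by metis
  then show "s \<in> p ` B" using * by blast
qed

lemma min_positive_image:
  assumes "min_positive G rG m"
  shows "p m \<in> p ` carrier G" "(\<one>\<^bsub>X\<^esub>, p m) \<in> r"
    "s \<in> p ` carrier G \<Longrightarrow> (\<one>\<^bsub>X\<^esub>, s) \<in> r \<Longrightarrow> (p m, s) \<in> r\<^sup>="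
  using assms one_lt_iff le_iff by (auto simp: min_positive_def)

text \<open>A convex \<open>B\<close> is recovered from its hull in \<open>X\<close> as the preimage
  under \<open>p\<close>.\<close>

lemma Conv_image_inj:
  assumes "order_convex (carrier G) rG B" "order_convex (carrier G) rG B'"
    and "Conv (carrier X) r (p ` B) = Conv (carrier X) r (p ` B')"
  shows "B = B'"
proof -
  have *: "B = {x \<in> carrier G. p x \<in> Conv (carrier X) r (p ` B)}"
    if B: "order_convex (carrier G) rG B" for B
  proof (intro equalityI subsetI CollectI conjI)
    have sub: "B \<subseteq> carrier G" using B by (simp add: order_convex_def)
    fix x
    show "x \<in> carrier G" "p x \<in> Conv (carrier X) r (p ` B)" if "x \<in> B"
      using that sub hom_carrier[OF p] by (auto simp: Conv_def)
    assume x: "x \<in> {x \<in> carrier G. p x \<in> Conv (carrier X) r (p ` B)}"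
    then obtain b b' where "b \<in> B" "b' \<in> B" "(p b, p x) \<in> r\<^sup>=" "(p x, p b') \<in> r\<^sup>="
      unfolding Conv_def by blast
    then show "x \<in> B"
      using B sub x le_iff unfolding order_convex_def by (metis (no_types, lifting) mem_Collect_eq subsetD)
  qed
  show ?thesis using *[OF assms(1)] *[OF assms(2)] assms(3) by simp
qed

end

section \<open>From steppings in the factors to the hull in the amalgam\<close>

text \<open>For the greatest \<open>m\<close> in \<open>A\<close> below \<open>x\<close>, the
  product of \<open>m\<close> with the minimal positive element of \<open>A\<close> is a larger
  element of \<open>A\<close>, so by maximality it lies above \<open>x\<close>.\<close>

lemma stepping_floor:
  assumes rX: "left_ordered_group X r" and emb: "order_embedding G X p rG r"
    and A: "group A" and i: "i \<in> hom A G" and rA: "Res A i rG = rA"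
    and step: "stepping G rG A i" and amin: "min_positive A rA a" and x: "x \<in> p ` carrier G"
  shows "\<exists>m\<in>(p \<circ> i) ` carrier A. (m, x) \<in> r\<^sup>= \<and> (x, m \<otimes>\<^bsub>X\<^esub> p (i a)) \<in> r"
proof -
  interpret X: left_ordered_group X r by (rule rX)
  interpret emb: order_embedding G X p rG r by (rule emb)
  have ic: "i m \<in> carrier G" if "m \<in> carrier A" for m using i that by (auto simp: hom_def)
  have pc: "p g \<in> carrier X" if "g \<in> carrier G" for g using emb.p that by (auto simp: hom_def)
  obtain g where g: "g \<in> carrier G" "x = p g" using x by blast
  have a: "a \<in> carrier A" "(\<one>\<^bsub>A\<^esub>, a) \<in> rA" using amin by (auto simp: min_positive_def)
  obtain m where m: "m \<in> carrier A" "(i m, g) \<in> rG\<^sup>="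
      "\<forall>b\<in>carrier A. (i b, g) \<in> rG\<^sup>= \<longrightarrow> (i b, i m) \<in> rG\<^sup>="
    using step g unfolding stepping_def by blast
  have ma: "m \<otimes>\<^bsub>A\<^esub> a \<in> carrier A" using A m a by (simp add: group.is_monoid monoid.m_closed)
  have eq: "p (i (m \<otimes>\<^bsub>A\<^esub> a)) = p (i m) \<otimes>\<^bsub>X\<^esub> p (i a)"
    using i emb.p m a ic by (simp add: hom_mult)
  have "(\<one>\<^bsub>X\<^esub>, p (i a)) \<in> r"
    using a rA emb.one_lt_iff[OF ic] hom_one[OF i A emb.G] by (auto simp: Res_def)
  then have "(p (i m), p (i (m \<otimes>\<^bsub>A\<^esub> a))) \<in> r"
    using X.mult_lt[of "p (i m)" "\<one>\<^bsub>X\<^esub>" "p (i a)"] eq pc ic m by simp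
  then have "\<not> (p (i (m \<otimes>\<^bsub>A\<^esub> a)), p (i m)) \<in> r\<^sup>="
    using X.lt_irrefl X.strict_trans1 by blast
  then have "\<not> (i (m \<otimes>\<^bsub>A\<^esub> a), g) \<in> rG\<^sup>="
    using m ma ic emb.le_iff by metis
  then have "(x, p (i m) \<otimes>\<^bsub>X\<^esub> p (i a)) \<in> r"
    using g emb.le_iff[OF ic[OF ma] g(1)] X.not_le[OF pc[OF ic[OF ma]] pc[OF g(1)]] eq by metis
  moreover have "(p (i m), x) \<in> r\<^sup>=" using m g ic emb.le_iff by metis
  ultimately show ?thesis using m(1) by (intro bexI[of _ "p (i m)"]) auto
qed

text \<open>Stated for arbitrary order embeddings \<open>p\<close> and \<open>q\<close>, so that it
  can be applied a second time with the two factors exchanged.\<close>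

lemma Conv_subgroup_of_generated:
  assumes A: "group A" and i: "i \<in> hom A G" and j: "j \<in> hom A H"
    and p: "order_embedding G X p rG r" and q: "order_embedding H X q rH r"
    and glue: "\<And>a. a \<in> carrier A \<Longrightarrow> p (i a) = q (j a)"
    and gen: "generate X (p ` carrier G \<union> q ` carrier H) = carrier X"
    and rA: "Res A i rG = rA" "Res A j rH = rA" "left_ordering A rA"
    and step: "stepping G rG A i" "stepping H rH A j"
    and min: "min_positive G rG gmin" "min_positive H rH hmin" "min_positive A rA amin"
    and pos: "(\<one>\<^bsub>X\<^esub>, q hmin \<otimes>\<^bsub>X\<^esub> inv\<^bsub>X\<^esub> (p (i amin)) \<otimes>\<^bsub>X\<^esub> p gmin) \<in> r"
    and BG: "strongly_convex G rG A i B" and BH: "strongly_convex H rH A j B"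
  shows "subgroup (Conv (carrier X) r ((p \<circ> i) ` B)) X"
proof -
  interpret p: order_embedding G X p rG r by (rule p)
  interpret q: order_embedding H X q rH r by (rule q)
  interpret X: left_ordered_group X r
    using p.X p.r by (simp add: left_ordered_group_def left_ordered_group_axioms_def)
  have ic: "i \<in> carrier A \<rightarrow> carrier G" and jc: "j \<in> carrier A \<rightarrow> carrier H"
    using i j by (auto simp: hom_def)
  interpret pi: order_embedding A X "p \<circ> i" rA r
    using A p.X rA p.r hom_compose[OF i p.p] Res_comp[OF ic, of p r] p.Res
    by (intro order_embedding.intro) auto
  have img: "(p \<circ> i) ` S = q ` j ` S" if "S \<subseteq> carrier A" for S
    using that glue by (auto simp: image_iff subset_eq)
  have qj: "(q \<circ> j) ` carrier A = (p \<circ> i) ` carrier A" using glue by auto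
  have gc: "p gmin \<in> carrier X" "q hmin \<in> carrier X" "p (i amin) \<in> carrier X"
    using min p.p q.p ic by (auto simp: min_positive_def hom_def)
  interpret stepping_amalgam X r "(p \<circ> i) ` carrier A" "p ` carrier G" "q ` carrier H"
    "p (i amin)" "p gmin" "q hmin"
  proof (intro stepping_amalgam.intro stepping_amalgam_axioms.intro X.left_ordered_group_axioms)
    show "subgroup ((p \<circ> i) ` carrier A) X" "subgroup (p ` carrier G) X" "subgroup (q ` carrier H) X"
      using subgroup_image[OF A p.X pi.p] subgroup_image[OF p.G p.X p.p]
        subgroup_image[OF q.G p.X q.p] group.subgroup_self A p.G q.G by blast+
    show "(p \<circ> i) ` carrier A \<subseteq> p ` carrier G" using ic by auto
    show "(p \<circ> i) ` carrier A \<subseteq> q ` carrier H" unfolding qj[symmetric] using jc by auto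
    show "generate X (p ` carrier G \<union> q ` carrier H) = carrier X" by (rule gen)
    show "p (i amin) \<in> (p \<circ> i) ` carrier A" "(\<one>\<^bsub>X\<^esub>, p (i amin)) \<in> r"
      "\<And>s. s \<in> (p \<circ> i) ` carrier A \<Longrightarrow> (\<one>\<^bsub>X\<^esub>, s) \<in> r \<Longrightarrow> (p (i amin), s) \<in> r\<^sup>="
      using pi.min_positive_image[OF min(3)] unfolding comp_apply by metis+
    show "p gmin \<in> p ` carrier G"
      "\<And>s. s \<in> p ` carrier G \<Longrightarrow> (\<one>\<^bsub>X\<^esub>, s) \<in> r \<Longrightarrow> (p gmin, s) \<in> r\<^sup>="
      by (fact p.min_positive_image[OF min(1)])+
    show "q hmin \<in> q ` carrier H"
      "\<And>s. s \<in> q ` carrier H \<Longrightarrow> (\<one>\<^bsub>X\<^esub>, s) \<in> r \<Longrightarrow> (q hmin, s) \<in> r\<^sup>="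
      by (fact q.min_positive_image[OF min(2)])+
    show "\<exists>a\<in>(p \<circ> i) ` carrier A. (a, x) \<in> r\<^sup>= \<and> (x, a \<otimes>\<^bsub>X\<^esub> p (i amin)) \<in> r"
      if "x \<in> p ` carrier G \<union> q ` carrier H" for x
    proof -
      \<comment> \<open>The floors in \<open>G\<close> and in \<open>H\<close> thus refer to the
        same minimal positive element.\<close>
      have "p (i amin) = q (j amin)" using min glue by (simp add: min_positive_def)
      then show ?thesis
        using that stepping_floor[OF X.left_ordered_group_axioms p A i rA(1) step(1) min(3)]
          stepping_floor[OF X.left_ordered_group_axioms q A j rA(2) step(2) min(3)]
        unfolding qj by (metis UnE)
    qed
    have "inv\<^bsub>X\<^esub> x \<otimes>\<^bsub>X\<^esub> (x \<otimes>\<^bsub>X\<^esub> y) = y" "x \<otimes>\<^bsub>X\<^esub> (inv\<^bsub>X\<^esub> x \<otimes>\<^bsub>X\<^esub> y) = y"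
      if "x \<in> carrier X" "y \<in> carrier X" for x y
      using that by (simp_all add: X.m_assoc[symmetric])
    \<comment> \<open>Left multiplication by the inverse of the first two factors of the element in
      \<open>pos\<close> turns \<open>pos\<close> into \<open>gap\<close>.\<close>
    then have "(p (i amin) \<otimes>\<^bsub>X\<^esub> inv\<^bsub>X\<^esub> q hmin) \<otimes>\<^bsub>X\<^esub> (q hmin \<otimes>\<^bsub>X\<^esub> inv\<^bsub>X\<^esub> (p (i amin)) \<otimes>\<^bsub>X\<^esub> p gmin) = p gmin"
      using gc by (simp add: X.m_assoc)
    then show "(p (i amin) \<otimes>\<^bsub>X\<^esub> inv\<^bsub>X\<^esub> q hmin, p gmin) \<in> r"
      using X.mult_lt[OF _ pos, of "p (i amin) \<otimes>\<^bsub>X\<^esub> inv\<^bsub>X\<^esub> q hmin"] gc by simp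
  qed
  have B: "subgroup B A" "order_convex (carrier A) rA B"
    "subgroup (Conv (carrier G) rG (i ` B)) G" "subgroup (Conv (carrier H) rH (j ` B)) H"
    using BG BH rA by (simp_all add: strongly_convex_def)
  have sub: "B \<subseteq> carrier A" using B(1) by (rule subgroup.subset)
  show ?thesis
  proof (rule Conv_subgroup)
    show "subgroup ((p \<circ> i) ` B) X" by (rule subgroup_image[OF pi.G p.X pi.p B(1)])
    show "(p \<circ> i) ` B \<subseteq> (p \<circ> i) ` carrier A" using sub by blast
    show "order_convex ((p \<circ> i) ` carrier A) r ((p \<circ> i) ` B)"
      by (rule pi.order_convex_image[OF B(2)])
    show "subgroup (Conv (p ` carrier G) r ((p \<circ> i) ` B)) X"
      using p.subgroup_Conv_image[OF _ B(3)] sub ic by (auto simp: image_comp)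
    \<comment> \<open>The hypothesis on \<open>H\<close> concerns the image of \<open>B\<close>
      through \<open>j\<close>, which \<open>glue\<close> identifies with the image through
      \<open>i\<close>.\<close>
    show "subgroup (Conv (q ` carrier H) r ((p \<circ> i) ` B)) X"
      using q.subgroup_Conv_image[OF _ B(4)] sub jc img[OF sub] by auto
  qed
qed

section \<open>Strong convexity in the amalgamated free product\<close>

text \<open>By their uniqueness, the two isolated orderings of \<open>X\<close> are exactly the
  left-orderings that extend \<open>rG\<close> and \<open>rH\<close> and make one of the two given
  products positive; \<open>rX\<close> enters through these properties.\<close>

theorem proposition2p14:
  fixes G :: "('g, 'm) monoid_scheme" and H :: "('h, 'k) monoid_scheme"
    and A :: "('a, 'n) monoid_scheme"
    and i :: "'a \<Rightarrow> 'g" and j :: "'a \<Rightarrow> 'h"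
    and rG :: "'g rel" and rH :: "'h rel" and rA :: "'a rel"
    and gmin :: 'g and hmin :: 'h and amin :: 'a
    and X :: "('g + 'h) list set monoid"
    and p :: "'g \<Rightarrow> ('g + 'h) list set" and q :: "'h \<Rightarrow> ('g + 'h) list set"
    and rX :: "('g + 'h) list set rel"
  assumes "group G" and "group H" and "group A"
    and "i \<in> mon A G" and "j \<in> mon A H"
    and "left_ordering G rG" and "left_ordering H rH"
    and "discrete_ordering G rG" and "discrete_ordering H rH"
    and "Res A i rG = rA" and "Res A j rH = rA"
    and "stepping G rG A i" and "stepping H rH A j"
    and "isolated_ordering G rG" and "relatively_isolated H rH A j"
    and "min_positive G rG gmin" and "min_positive H rH hmin" and "min_positive A rA amin"
    and X_def: "X = amalgam G H A i j"
    and p_def: "p = amalgam_inl G H A i j" and q_def: "q = amalgam_inr G H A i j"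
    and "left_ordering X rX"
    and "Res G p rX = rG" and "Res H q rX = rH"
    and "(\<one>\<^bsub>X\<^esub>, q hmin \<otimes>\<^bsub>X\<^esub> inv\<^bsub>X\<^esub> (p (i amin)) \<otimes>\<^bsub>X\<^esub> p gmin) \<in> rX \<or>
         (\<one>\<^bsub>X\<^esub>, p gmin \<otimes>\<^bsub>X\<^esub> inv\<^bsub>X\<^esub> (p (i amin)) \<otimes>\<^bsub>X\<^esub> q hmin) \<in> rX"
  shows "(\<forall>B. subgroup B A \<and> strongly_convex G rG A i B \<and> strongly_convex H rH A j B \<longrightarrow>
            strongly_convex X rX A (p \<circ> i) B) \<and>
         (\<forall>B B'. subgroup B A \<and> strongly_convex G rG A i B \<and> strongly_convex H rH A j B \<and>
            subgroup B' A \<and> strongly_convex G rG A i B' \<and> strongly_convex H rH A j B' \<and>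
            B \<noteq> B' \<longrightarrow>
            subgroup (Conv (carrier X) rX ((p \<circ> i) ` B)) X \<and>
            order_convex (carrier X) rX (Conv (carrier X) rX ((p \<circ> i) ` B)) \<and>
            subgroup (Conv (carrier X) rX ((p \<circ> i) ` B')) X \<and>
            order_convex (carrier X) rX (Conv (carrier X) rX ((p \<circ> i) ` B')) \<and>
            Conv (carrier X) rX ((p \<circ> i) ` B) \<noteq> Conv (carrier X) rX ((p \<circ> i) ` B'))"
proof -
  interpret D: amalgam_data G H A i j
    using assms(1-5) by (auto simp: amalgam_data_def mon_def)
  have i: "i \<in> hom A G" and j: "j \<in> hom A H" by (rule D.i, rule D.j)
  have p: "p \<in> hom G X" and q: "q \<in> hom H X"
    unfolding X_def p_def q_def by (rule D.amalgam_inl_hom, rule D.amalgam_inr_hom)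
  have X: "group X" unfolding X_def by (rule D.amalgam_group)
  have glue: "p (i a) = q (j a)" if "a \<in> carrier A" for a
    unfolding p_def q_def using that by (rule D.amalgam_glue)
  have gen: "generate X (p ` carrier G \<union> q ` carrier H) = carrier X"
    unfolding X_def p_def q_def by (rule D.generate_amalgam)
  interpret p: order_embedding G X p rG rX
    using assms X p by (intro order_embedding.intro) auto
  interpret q: order_embedding H X q rH rX
    using assms X q by (intro order_embedding.intro) auto
  have resA: "Res A (p \<circ> i) rX = rA"
    using Res_comp[of i A G p rX] i assms by (simp add: hom_def)
  have rA: "left_ordering A rA"
    using left_ordering_Res assms by blast
  interpret pi: order_embedding A X "p \<circ> i" rA rX
    using assms X rA resA hom_compose[OF i p] by (intro order_embedding.intro) auto
  have img: "(p \<circ> i) ` B = (q \<circ> j) ` B" if "B \<subseteq> carrier A" for B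
    using that glue by (auto simp: image_iff subset_eq)
  have Conv: "subgroup (Conv (carrier X) rX ((p \<circ> i) ` B)) X"
    if B: "strongly_convex G rG A i B" "strongly_convex H rH A j B" for B
    using assms(25)
  proof
    assume "(\<one>\<^bsub>X\<^esub>, q hmin \<otimes>\<^bsub>X\<^esub> inv\<^bsub>X\<^esub> (p (i amin)) \<otimes>\<^bsub>X\<^esub> p gmin) \<in> rX"
    then show ?thesis
      using assms(10-13,16-18) rA glue gen B
      by (intro Conv_subgroup_of_generated[OF \<open>group A\<close> i j p.order_embedding_axioms
            q.order_embedding_axioms]) auto
  next
    assume "(\<one>\<^bsub>X\<^esub>, p gmin \<otimes>\<^bsub>X\<^esub> inv\<^bsub>X\<^esub> (p (i amin)) \<otimes>\<^bsub>X\<^esub> q hmin) \<in> rX"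
    \<comment> \<open>The second ordering is the first with \<open>G\<close> and \<open>H\<close>
      exchanged, once the middle factor is written through \<open>j\<close>.\<close>
    moreover have "p (i amin) = q (j amin)" using glue assms(18) by (simp add: min_positive_def)
    ultimately have "subgroup (Conv (carrier X) rX ((q \<circ> j) ` B)) X"
      using assms(10-13,16-18) rA glue gen B
      by (intro Conv_subgroup_of_generated[OF \<open>group A\<close> j i q.order_embedding_axioms
            p.order_embedding_axioms]) (auto simp: Un_commute)
    moreover have "B \<subseteq> carrier A" using B(1) by (auto simp: strongly_convex_def subgroup.subset)
    ultimately show ?thesis using img by metis
  qed
  have convex: "order_convex (carrier A) rA B" if "strongly_convex G rG A i B" for B
    using that assms(10) by (simp add: strongly_convex_def)
  interpret lo: left_ordered_group X rX
    using X assms(22) by (simp add: left_ordered_group_def left_ordered_group_axioms_def)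
  have Conv_convex: "order_convex (carrier X) rX (Conv (carrier X) rX S)" for S
    unfolding order_convex_def
  proof (intro conjI ballI impI; (elim conjE)?)
    show "Conv (carrier X) rX S \<subseteq> carrier X" by (auto simp: Conv_def)
    fix c c' s
    assume "c \<in> Conv (carrier X) rX S" "c' \<in> Conv (carrier X) rX S" "s \<in> carrier X"
      "(c, s) \<in> rX\<^sup>=" "(s, c') \<in> rX\<^sup>="
    then show "s \<in> Conv (carrier X) rX S"
      unfolding Conv_def mem_Collect_eq by (metis lo.trans)
  qed
  show ?thesis
    using Conv convex Conv_convex pi.Conv_image_inj resA
    unfolding strongly_convex_def[of X] by blast
qed

end
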